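(* Let $i\in\mathbb{N}=\{1,2,3,\dots\}$, and let $\psi^{(i)}$ denote the $i$-th polygamma function. Then the equation $$2\bigl|\psi^{(i)}(\theta)\bigr|=\bigl|\psi^{(i)}(\theta^2)\bigr|$$ has a unique root $\theta_i$ in the interval $(0,1)$, and the function $x\mapsto\bigl|\psi^{(i)}(e^x)\bigr|$ is super-additive on $(-\infty,\ln\theta_i)$ and sub-additive on $(\ln\theta_i,\infty)$.
   Context: The Euler gamma function is $\Gamma(x)=\int_0^\infty t^{x-1}e^{-t}\,dt$ for $x>0$; the digamma function is $\psi(x)=\Gamma'(x)/\Gamma(x)$ for $x>0$; for $i\in\mathbb{N}$ the polygamma function $\psi^{(i)}$ is the $i$-th derivative of $\psi$ on $(0,\infty)$. A real function $f$ is said to be sub-additive on an interval $I$ if $f(x+y)\le f(x)+f(y)$ holds for all $x,y\in I$ such that $x+y\in I$. It is super-additive on $I$ if the reversed inequality $f(x+y)\ge f(x)+f(y)$ holds for all $x,y\in I$ such that $x+y\in I$. *)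

theory Defs
  imports "HOL-Analysis.Analysis"
begin

definition sub_additive_on :: "real set \<Rightarrow> (real \<Rightarrow> real) \<Rightarrow> bool" where
  "sub_additive_on I f \<longleftrightarrow>
     (\<forall>x\<in>I. \<forall>y\<in>I. x + y \<in> I \<longrightarrow> f (x + y) \<le> f x + f y)"

definition super_additive_on :: "real set \<Rightarrow> (real \<Rightarrow> real) \<Rightarrow> bool" where
  "super_additive_on I f \<longleftrightarrow>
     (\<forall>x\<in>I. \<forall>y\<in>I. x + y \<in> I \<longrightarrow> f (x + y) \<ge> f x + f y)"

(* The library defines Polygamma by a series. On the positive reals it is the iterated
   derivative of the logarithmic derivative of Gamma; the theorem Gamma_integral_real
   gives Euler's integral for Gamma. *)
lemma higher_deriv_log_deriv_Gamma:
  fixes x :: real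
  assumes "x > 0"
  shows "(deriv ^^ i) (\<lambda>t. deriv Gamma t / Gamma t) x = Polygamma i x"
proof -
  have pos: "t \<notin> \<int>\<^sub>\<le>\<^sub>0" if "t > 0" for t :: real
    using that by (auto elim!: nonpos_Ints_cases)
  have "deriv Gamma t / Gamma t = Digamma t" if "t > 0" for t :: real
  proof -
    have "deriv Gamma t = Gamma t * Digamma t"
      by (intro DERIV_imp_deriv has_field_derivative_Gamma pos that)
    then show ?thesis
      using Gamma_real_pos[OF that] by simp
  qed
  moreover have "eventually (\<lambda>t. t \<in> {0<..}) (nhds x)"
    using assms by (intro eventually_nhds_in_open) auto
  ultimately have "eventually (\<lambda>t. deriv Gamma t / Gamma t = Digamma t) (nhds x)"
    by (auto elim!: eventually_mono)
  then have "(deriv ^^ i) (\<lambda>t. deriv Gamma t / Gamma t) x = (deriv ^^ i) Digamma x"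
    by (rule higher_deriv_cong_ev) simp
  also have "\<dots> = Polygamma i x"
    using higher_deriv_Polygamma[OF pos[OF assms], of i 0] by simp
  finally show ?thesis .
qed

end

theory Submission
  imports Defs
begin

text \<open>
  Put \<open>h(x) = \<bar>\<psi>\<^sup>(\<^sup>i\<^sup>)(x)\<bar>\<close> and \<open>G(u,v) = h(u) + h(v) - h(uv)\<close>. Since
  \<open>u \<partial>\<^sub>uG(u,v) = p(uv) - p(u)\<close> with \<open>p(x) = x \<bar>\<psi>\<^sup>(\<^sup>i\<^sup>+\<^sup>1\<^sup>)(x)\<bar>\<close>, and \<open>p\<close> is strictly decreasing,
  \<open>G\<close> increases in each variable on \<open>(0,1)\<^sup>2\<close>; so its sign there is governed by the unique zero
  \<open>\<theta>\<close> of \<open>u \<mapsto> G(u,u)\<close>. If one argument is at least \<open>1\<close>, sub-additivity is just monotonicity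
  of \<open>h\<close>. That \<open>p\<close> decreases means \<open>\<Sum>\<^sub>k (m x (x+k)\<^sup>-\<^sup>m\<^sup>-\<^sup>1 - (x+k)\<^sup>-\<^sup>m) > 0\<close> for \<open>m \<ge> 3\<close>;
  this series dominates termwise the telescoping series with partial sums \<open>2k (x+k)\<^sup>-\<^sup>m\<close>,
  whose sum is \<open>0\<close>.
\<close>

section \<open>Elementary series estimates\<close>

lemma telescoping_minorant:
  fixes u :: real and k m :: nat
  assumes "u > 0" "m \<ge> 3"
  defines "s \<equiv> u + real k"
  shows "2 * (real k + 1) / (s + 1) ^ m - 2 * real k / s ^ m < real m * u / s ^ Suc m - 1 / s ^ m"
proof -
  have s: "s > 0" and us: "u = s - real k"
    using assms by (auto simp: s_def)
  \<comment> \<open>Multiplying the claim by \<open>s ^ Suc m\<close> leaves only powers of this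
    ratio: it becomes the inequality \<open>main\<close> below.\<close>
  define a where "a = s / (s + 1)"
  have a: "0 < a" "a < 1" and as: "a * (s + 1) = s"
    using s by (auto simp: a_def)
  \<comment> \<open>The bracket equals \<open>(3 * s\<^sup>2 - 1) / (s + 1)\<^sup>2\<close>, which
    is negative for small \<open>s\<close>; but then \<open>k = 0\<close>, since
    \<open>k \<ge> 1\<close> forces \<open>s \<ge> 1\<close>.\<close>
  have "real k * (2 * s - 1 - 2 * s * a\<^sup>2) \<ge> 0"
  proof (cases "k = 0")
    case False
    then have s1: "s \<ge> 1"
      using assms by (simp add: s_def)
    have "(2 * s - 1 - 2 * s * a\<^sup>2) * (s + 1)\<^sup>2 = (2 * s - 1) * (s + 1)\<^sup>2 - 2 * s * (a * (s + 1))\<^sup>2"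
      by (simp add: algebra_simps power2_eq_square)
    also have "\<dots> = 3 * s\<^sup>2 - 1"
      unfolding as by (simp add: algebra_simps power2_eq_square)
    also have "\<dots> \<ge> 0"
      using one_le_power[OF s1, of 2] by linarith
    finally have "2 * s - 1 - 2 * s * a\<^sup>2 \<ge> 0"
      using s by (simp add: zero_le_mult_iff)
    then show ?thesis by simp
  qed simp
  moreover have "u * (2 - 2 * a ^ 3) > 0"
    using \<open>u > 0\<close> a power_strict_mono[of a 1 3] by simp
  \<comment> \<open>This is right side minus left side of \<open>main\<close> for
    \<open>m = 3\<close>. The two expressions agree only modulo the relation
    \<open>a * (s + 1) = s\<close>.\<close>
  moreover have "3 * u - s + 2 * real k * s - 2 * (real k + 1) * a ^ 3 * s
      = real k * (2 * s - 1 - 2 * s * a\<^sup>2) + u * (2 - 2 * a ^ 3)"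
  proof -
    have "(3 * u - s + 2 * real k * s - 2 * (real k + 1) * a ^ 3 * s)
        - (real k * (2 * s - 1 - 2 * s * a\<^sup>2) + u * (2 - 2 * a ^ 3))
        = - 2 * real k * a\<^sup>2 * (a * (s + 1) - s)"
      unfolding us by (simp add: algebra_simps power2_eq_square power3_eq_cube)
    then show ?thesis by (simp add: as)
  qed
  ultimately have cubic: "2 * (real k + 1) * a ^ 3 * s - 2 * real k * s < 3 * u - s"
    by linarith
  \<comment> \<open>The case \<open>m = 3\<close> is the worst one: as \<open>m\<close> grows, the
    left side of \<open>main\<close> shrinks because \<open>a < 1\<close>, and the right side
    grows.\<close>
  have "2 * (real k + 1) * a ^ m * s \<le> 2 * (real k + 1) * a ^ 3 * s"
    using a s \<open>m \<ge> 3\<close> by (intro mult_right_mono mult_left_mono power_decreasing) auto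
  moreover have "3 * u \<le> real m * u"
    using \<open>m \<ge> 3\<close> \<open>u > 0\<close> by simp
  ultimately have main: "2 * (real k + 1) * a ^ m * s - 2 * real k * s < real m * u - s"
    using cubic by linarith
  have "2 * (real k + 1) / (s + 1) ^ m - 2 * real k / s ^ m
      = (2 * (real k + 1) * a ^ m * s - 2 * real k * s) / s ^ Suc m"
    using s by (simp add: a_def power_divide field_simps)
  also have "\<dots> < (real m * u - s) / s ^ Suc m"
    using main s by (intro divide_strict_right_mono) auto
  also have "\<dots> = real m * u / s ^ Suc m - 1 / s ^ m"
    using s by (simp add: field_simps)
  finally show ?thesis .
qed

text \<open>The differences of \<open>b\<close> sum to \<open>0\<close>, so subtracting them
  termwise keeps the sum \<open>S\<close> and makes every term positive.\<close>

lemma sums_pos_of_telescoping_minorant: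
  fixes f b :: "nat \<Rightarrow> real"
  assumes "f sums S" "b \<longlonglongrightarrow> 0" "b 0 = 0" "\<And>k. b (Suc k) - b k < f k"
  shows "S > 0"
proof -
  have "(\<lambda>k. b (Suc k) - b k) sums 0"
    using telescope_sums[OF assms(2)] assms(3) by simp
  from sums_diff[OF assms(1) this]
  have d: "(\<lambda>k. f k - (b (Suc k) - b k)) sums S" by simp
  have "0 < (\<Sum>k. f k - (b (Suc k) - b k))"
    using d assms(4) by (intro suminf_pos) (auto simp: sums_iff)
  with d show ?thesis by (simp add: sums_iff)
qed

section \<open>Absolute values of polygamma functions on the positive reals\<close>

lemma pos_not_nonpos_Ints: "x > 0 \<Longrightarrow> x \<notin> \<int>\<^sub>\<le>\<^sub>0" for x :: real
  by (auto elim!: nonpos_Ints_cases)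

lemma abs_Polygamma_real:
  fixes x :: real
  assumes "n > 0" "x > 0"
  shows "\<bar>Polygamma n x\<bar> = (-1) ^ Suc n * Polygamma n x"
proof (cases "even n")
  case True
  then show ?thesis
    using Polygamma_real_even_neg[of x n] assms by simp
next
  case False
  then show ?thesis
    using Polygamma_real_odd_pos[of x n] assms pos_not_nonpos_Ints by simp
qed

lemma abs_Polygamma_sums:
  fixes x :: real
  assumes "n > 0" "x > 0"
  shows "(\<lambda>k. 1 / (x + real k) ^ Suc n) sums (\<bar>Polygamma n x\<bar> / fact n)"
  using Polygamma_LIMSEQ[of x n] assms abs_Polygamma_real[OF assms]
  by (simp add: inverse_eq_divide)

lemma abs_Polygamma_pos:
  fixes x :: real
  assumes "n > 0" "x > 0"
  shows "\<bar>Polygamma n x\<bar> > 0"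
  using Polygamma_real_even_neg[of x n] Polygamma_real_odd_pos[of x n] assms pos_not_nonpos_Ints
  by (cases "even n") force+

text \<open>Splits off the pole at \<open>0\<close>; the remaining term stays bounded there, which
  gives the growth near \<open>0\<close>.\<close>

lemma abs_Polygamma_plus1:
  fixes x :: real
  assumes "n > 0" "x > 0"
  shows "\<bar>Polygamma n x\<bar> = \<bar>Polygamma n (x + 1)\<bar> + fact n / x ^ Suc n"
proof -
  have "(-1) ^ Suc n * (-1) ^ n = (-1 :: real)"
    by (simp flip: power_mult_distrib)
  then have "(-1) ^ Suc n * Polygamma n (x + 1) = (-1) ^ Suc n * Polygamma n x - fact n / x ^ Suc n"
    using Polygamma_plus1[of x n] assms by (simp add: ring_distribs flip: mult.assoc)
  then show ?thesis
    using assms by (simp add: abs_Polygamma_real del: power_Suc)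
qed

lemma has_real_derivative_abs_Polygamma:
  fixes x :: real
  assumes "n > 0" "x > 0"
  shows "((\<lambda>x. \<bar>Polygamma n x\<bar>) has_real_derivative - \<bar>Polygamma (Suc n) x\<bar>) (at x)"
proof -
  have "((\<lambda>x. (-1) ^ Suc n * Polygamma n x) has_real_derivative - \<bar>Polygamma (Suc n) x\<bar>) (at x)"
    using assms pos_not_nonpos_Ints
    by (auto intro!: derivative_eq_intros simp: abs_Polygamma_real)
  moreover have "eventually (\<lambda>t. \<bar>Polygamma n t\<bar> = (-1) ^ Suc n * Polygamma n t) (nhds x)"
    using eventually_nhds_in_open[of "{0<..}" x] assms
    by (auto elim!: eventually_mono simp: abs_Polygamma_real)
  ultimately show ?thesis
    by (subst DERIV_cong_ev[OF refl _ refl]) auto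
qed

lemma abs_Polygamma_antimono:
  fixes x y :: real
  assumes "n > 0" "0 < x" "x \<le> y"
  shows "\<bar>Polygamma n y\<bar> \<le> \<bar>Polygamma n x\<bar>"
proof (rule DERIV_nonpos_imp_nonincreasing[OF \<open>x \<le> y\<close>])
  fix t assume "x \<le> t" "t \<le> y"
  then show "\<exists>d. ((\<lambda>x. \<bar>Polygamma n x\<bar>) has_real_derivative d) (at t) \<and> d \<le> 0"
    using has_real_derivative_abs_Polygamma[of n t] assms by force
qed

text \<open>Equivalently, \<open>x * \<bar>Polygamma n x\<bar>\<close> has negative derivative.
  Right side minus left side, divided by \<open>fact n\<close>, is the series of \<open>?f\<close>,
  and \<open>n \<ge> 2\<close> gives the exponent \<open>m \<ge> 3\<close> that the minorant
  needs.\<close>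

lemma abs_Polygamma_less_Suc:
  fixes x :: real
  assumes "n \<ge> 2" "x > 0"
  shows "\<bar>Polygamma n x\<bar> < x * \<bar>Polygamma (Suc n) x\<bar>"
proof -
  define m where "m = Suc n"
  let ?f = "\<lambda>k. real m * x / (x + real k) ^ Suc m - 1 / (x + real k) ^ m"
  let ?b = "\<lambda>k. 2 * real k / (x + real k) ^ m"
  have "(\<lambda>k. real m * x * (1 / (x + real k) ^ Suc m) - 1 / (x + real k) ^ m) sums
      (real m * x * (\<bar>Polygamma m x\<bar> / fact m) - \<bar>Polygamma n x\<bar> / fact n)"
    unfolding m_def using assms
    by (intro sums_diff sums_mult abs_Polygamma_sums) auto
  then have "?f sums (real m * x * (\<bar>Polygamma m x\<bar> / fact m) - \<bar>Polygamma n x\<bar> / fact n)"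
    by simp
  moreover have "?b \<longlonglongrightarrow> 0"
  proof (rule tendsto_sandwich)
    show "\<forall>\<^sub>F k in sequentially. 0 \<le> ?b k"
      using assms by (intro always_eventually) auto
    \<comment> \<open>Only the square in the denominator matters: \<open>(x + k) ^ m\<close> is at
      least \<open>k\<^sup>2\<close> once the base is at least \<open>1\<close>.\<close>
    show "\<forall>\<^sub>F k in sequentially. ?b k \<le> 2 / real k"
    proof (rule eventually_sequentiallyI[of 1])
      fix k :: nat assume k: "k \<ge> 1"
      have "real k * real k \<le> (x + real k)\<^sup>2"
        using assms by (simp add: power2_eq_square mult_mono)
      also have "\<dots> \<le> (x + real k) ^ m"
        using assms k by (intro power_increasing) (auto simp: m_def)
      finally show "?b k \<le> 2 / real k"
        using assms k by (simp add: field_simps)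
    qed
    show "(\<lambda>k. 2 / real k) \<longlonglongrightarrow> 0"
      by (rule lim_const_over_n)
  qed simp
  moreover have "?b (Suc k) - ?b k < ?f k" for k
    using telescoping_minorant[of x m k] assms by (simp add: m_def add_ac)
  ultimately have "real m * x * (\<bar>Polygamma m x\<bar> / fact m) - \<bar>Polygamma n x\<bar> / fact n > 0"
    by (intro sums_pos_of_telescoping_minorant[where f = ?f and b = ?b]) auto
  moreover have "real m * x * (\<bar>Polygamma m x\<bar> / fact m) = x * \<bar>Polygamma m x\<bar> / fact n"
    by (simp add: m_def del: of_nat_Suc)
  ultimately show ?thesis
    by (simp add: m_def divide_less_cancel)
qed

lemma mult_abs_Polygamma_strict_antimono:
  fixes x y :: real
  assumes "n \<ge> 2" "0 < x" "x < y"
  shows "y * \<bar>Polygamma n y\<bar> < x * \<bar>Polygamma n x\<bar>"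
proof (rule DERIV_neg_imp_decreasing[OF \<open>x < y\<close>])
  fix t assume "x \<le> t" "t \<le> y"
  then have t: "t > 0" using assms by simp
  have "((\<lambda>x. x * \<bar>Polygamma n x\<bar>) has_real_derivative
      (\<bar>Polygamma n t\<bar> - t * \<bar>Polygamma (Suc n) t\<bar>)) (at t)"
    using assms t
    by (auto intro!: derivative_eq_intros has_real_derivative_abs_Polygamma)
  then show "\<exists>d. ((\<lambda>x. x * \<bar>Polygamma n x\<bar>) has_real_derivative d) (at t) \<and> d < 0"
    using abs_Polygamma_less_Suc[of n t] assms t by force
qed

section \<open>The function \<open>G\<close>: monotonicity and its zero on the diagonal\<close>

definition Polygamma_defect :: "nat \<Rightarrow> real \<Rightarrow> real \<Rightarrow> real" where
  "Polygamma_defect n u v = \<bar>Polygamma n u\<bar> + \<bar>Polygamma n v\<bar> - \<bar>Polygamma n (u * v)\<bar>"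

lemma Polygamma_defect_commute: "Polygamma_defect n u v = Polygamma_defect n v u"
  by (simp add: Polygamma_defect_def mult.commute)

lemma Polygamma_defect_strict_mono:
  assumes "n > 0" "0 < u" "u < u'" "0 < v" "v < 1"
  shows "Polygamma_defect n u v < Polygamma_defect n u' v"
proof (rule DERIV_pos_imp_increasing[OF \<open>u < u'\<close>])
  fix t assume "u \<le> t" "t \<le> u'"
  then have t: "t > 0" using assms by simp
  let ?d = "v * \<bar>Polygamma (Suc n) (t * v)\<bar> - \<bar>Polygamma (Suc n) t\<bar>"
  have "((\<lambda>t. \<bar>Polygamma n (t * v)\<bar>) has_real_derivative - \<bar>Polygamma (Suc n) (t * v)\<bar> * v) (at t)"
    using assms t
    by (intro DERIV_chain2[OF has_real_derivative_abs_Polygamma]) (auto intro!: derivative_eq_intros)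
  then have "((\<lambda>t. Polygamma_defect n t v) has_real_derivative ?d) (at t)"
    unfolding Polygamma_defect_def using assms t
    by (auto intro!: derivative_eq_intros has_real_derivative_abs_Polygamma)
  \<comment> \<open>This is \<open>t * ?d > 0\<close>. Since \<open>v < 1\<close>, the point
    \<open>t * v\<close> lies left of \<open>t\<close>, and \<open>n > 0\<close> makes the order
    \<open>Suc n\<close> at least \<open>2\<close>.\<close>
  moreover have "t * \<bar>Polygamma (Suc n) t\<bar> < t * v * \<bar>Polygamma (Suc n) (t * v)\<bar>"
    using assms t by (intro mult_abs_Polygamma_strict_antimono) auto
  then have "?d > 0"
    using t by simp
  ultimately show "\<exists>d. ((\<lambda>t. Polygamma_defect n t v) has_real_derivative d) (at t) \<and> 0 < d"
    by blast
qed

lemma Polygamma_defect_strict_mono2: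
  assumes "n > 0" "0 < u" "u < u'" "u' < 1" "0 < v" "v < v'" "v' < 1"
  shows "Polygamma_defect n u v < Polygamma_defect n u' v'"
proof -
  have "Polygamma_defect n u v < Polygamma_defect n u' v"
    using assms by (intro Polygamma_defect_strict_mono) auto
  \<comment> \<open>By symmetry \<open>u'\<close> now plays the part of the fixed argument, hence
    \<open>u' < 1\<close>.\<close>
  also have "\<dots> < Polygamma_defect n u' v'"
    using assms Polygamma_defect_strict_mono[of n v v' u'] by (simp add: Polygamma_defect_commute)
  finally show ?thesis .
qed

text \<open>Near \<open>0\<close> the pole makes \<open>\<bar>Polygamma n a\<bar>\<close> grow like
  \<open>fact n * w\<close> with \<open>w = 1 / a ^ Suc n\<close>, but
  \<open>\<bar>Polygamma n (a * a)\<bar>\<close> like \<open>fact n * w\<^sup>2\<close>.\<close>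

lemma Polygamma_defect_diag_neg:
  assumes "n > 0"
  obtains a where "0 < a" "a < 1" "Polygamma_defect n a a < 0"
proof
  define c where "c = \<bar>Polygamma n (1 :: real)\<bar>"
  have c: "c > 0"
    unfolding c_def using assms by (intro abs_Polygamma_pos) auto
  \<comment> \<open>Chosen so that \<open>w \<ge> 1 / a = 2 + 2 * c\<close>; then
    \<open>fact n * w\<^sup>2\<close> is at least \<open>2 * fact n * w + 2 * c\<close>, the upper
    bound for \<open>2 * \<bar>Polygamma n a\<bar>\<close>.\<close>
  define a where "a = 1 / (2 + 2 * c)"
  show a: "0 < a" "a < 1"
    using c by (auto simp: a_def)
  define w where "w = 1 / a ^ Suc n"
  have "a ^ Suc n \<le> a ^ 1"
    using a by (intro power_decreasing) auto
  then have "1 / a \<le> w"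
    using a by (simp add: w_def field_simps)
  then have w: "w \<ge> 2 + 2 * c"
    by (simp add: a_def)
  have f: "fact n \<ge> (1 :: real)"
    by (rule fact_ge_1)
  have "\<bar>Polygamma n a\<bar> \<le> c + fact n * w"
    using abs_Polygamma_plus1[of n a] abs_Polygamma_antimono[of n 1 "a + 1"] assms a
    by (simp add: c_def w_def)
  moreover have "\<bar>Polygamma n (a * a)\<bar> > fact n * (w * w)"
    using abs_Polygamma_plus1[of n "a * a"] abs_Polygamma_pos[of n "a * a + 1"] assms a
      mult_pos_pos[OF a(1) a(1)]
    by (simp add: w_def power_mult_distrib add_pos_pos del: power_Suc)
  moreover have "fact n * (w * w) \<ge> fact n * (w * (2 + 2 * c))"
    using w c f by (intro mult_left_mono) auto
  moreover have "fact n * (w * c) \<ge> 1 * (1 * c)"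
    using w c f by (intro mult_mono) auto
  ultimately show "Polygamma_defect n a a < 0"
    unfolding Polygamma_defect_def by (simp add: algebra_simps)
qed

text \<open>The diagonal is negative somewhere and positive at \<open>1\<close>, so the intermediate
  value theorem gives a zero; strict monotonicity in both arguments makes it unique.\<close>

lemma Polygamma_defect_diag_zero:
  assumes "n > 0"
  shows "\<exists>!\<theta>. \<theta> \<in> {0<..<1} \<and> Polygamma_defect n \<theta> \<theta> = 0"
proof (rule ex_ex1I)
  obtain a where a: "0 < a" "a < 1" "Polygamma_defect n a a < 0"
    using Polygamma_defect_diag_neg[OF assms] .
  have one: "Polygamma_defect n 1 1 > 0"
    using abs_Polygamma_pos[of n 1] assms by (simp add: Polygamma_defect_def)
  have "continuous_on {a..1} (\<lambda>t. Polygamma_defect n t t)"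
    unfolding Polygamma_defect_def
    using a pos_not_nonpos_Ints
    by (intro continuous_at_imp_continuous_on ballI continuous_intros) auto
  from IVT'[of "\<lambda>t. Polygamma_defect n t t" a 0 1, OF _ _ _ this] a one
  obtain \<theta> where "a \<le> \<theta>" "\<theta> \<le> 1" "Polygamma_defect n \<theta> \<theta> = 0"
    by auto
  moreover from this one have "\<theta> \<noteq> 1" by auto
  ultimately show "\<exists>\<theta>. \<theta> \<in> {0<..<1} \<and> Polygamma_defect n \<theta> \<theta> = 0"
    using a by (intro exI[of _ \<theta>]) auto
next
  fix x y :: real
  assume "x \<in> {0<..<1} \<and> Polygamma_defect n x x = 0"
    and "y \<in> {0<..<1} \<and> Polygamma_defect n y y = 0"
  then show "x = y"
    using Polygamma_defect_strict_mono2[of n x y x y] Polygamma_defect_strict_mono2[of n y x y x] assms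
    by (cases x y rule: linorder_cases) auto
qed

lemma Polygamma_defect_nonneg:
  assumes "n > 0" "0 < u" "1 \<le> v"
  shows "Polygamma_defect n u v \<ge> 0"
  using abs_Polygamma_antimono[of n u "u * v"] assms
  by (simp add: Polygamma_defect_def)

section \<open>Passage to additivity through the exponential function\<close>

theorem theorem1:
  fixes i :: nat
  assumes "i \<ge> 1"
  shows "(\<exists>!\<theta>::real. \<theta> \<in> {0<..<1} \<and> 2 * \<bar>Polygamma i \<theta>\<bar> = \<bar>Polygamma i (\<theta>\<^sup>2)\<bar>) \<and>
    (\<forall>\<theta>::real. \<theta> \<in> {0<..<1} \<and> 2 * \<bar>Polygamma i \<theta>\<bar> = \<bar>Polygamma i (\<theta>\<^sup>2)\<bar> \<longrightarrow>
       super_additive_on {..<ln \<theta>} (\<lambda>x. \<bar>Polygamma i (exp x)\<bar>) \<and>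
       sub_additive_on {ln \<theta><..} (\<lambda>x. \<bar>Polygamma i (exp x)\<bar>))"
proof -
  have i: "i > 0" using assms by simp
  have root: "2 * \<bar>Polygamma i \<theta>\<bar> = \<bar>Polygamma i (\<theta>\<^sup>2)\<bar> \<longleftrightarrow> Polygamma_defect i \<theta> \<theta> = 0" for \<theta> :: real
    by (auto simp: Polygamma_defect_def power2_eq_square)
  have defect_exp: "Polygamma_defect i (exp x) (exp y) =
      \<bar>Polygamma i (exp x)\<bar> + \<bar>Polygamma i (exp y)\<bar> - \<bar>Polygamma i (exp (x + y))\<bar>" for x y :: real
    by (simp add: Polygamma_defect_def exp_add)
  have "super_additive_on {..<ln \<theta>} (\<lambda>x. \<bar>Polygamma i (exp x)\<bar>) \<and>
      sub_additive_on {ln \<theta><..} (\<lambda>x. \<bar>Polygamma i (exp x)\<bar>)"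
    if \<theta>: "0 < \<theta>" "\<theta> < 1" and zero: "Polygamma_defect i \<theta> \<theta> = 0" for \<theta> :: real
  proof
    have below: "exp x < \<theta> \<longleftrightarrow> x < ln \<theta>" and above: "\<theta> < exp x \<longleftrightarrow> ln \<theta> < x" for x
      using \<theta> by (metis exp_less_cancel_iff exp_ln)+
    show "super_additive_on {..<ln \<theta>} (\<lambda>x. \<bar>Polygamma i (exp x)\<bar>)"
      unfolding super_additive_on_def
    proof (intro ballI impI)
      fix x y assume "x \<in> {..<ln \<theta>}" "y \<in> {..<ln \<theta>}"
      then have "Polygamma_defect i (exp x) (exp y) < Polygamma_defect i \<theta> \<theta>"
        using \<theta> i by (intro Polygamma_defect_strict_mono2) (auto simp: below)
      then show "\<bar>Polygamma i (exp (x + y))\<bar> \<ge> \<bar>Polygamma i (exp x)\<bar> + \<bar>Polygamma i (exp y)\<bar>"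
        by (simp add: zero defect_exp)
    qed
    show "sub_additive_on {ln \<theta><..} (\<lambda>x. \<bar>Polygamma i (exp x)\<bar>)"
      unfolding sub_additive_on_def
    proof (intro ballI impI)
      fix x y assume xy: "x \<in> {ln \<theta><..}" "y \<in> {ln \<theta><..}"
      \<comment> \<open>The comparison with the diagonal zero is available only when both
        exponentials are below \<open>1\<close>; otherwise one factor is at least \<open>1\<close>
        and monotonicity suffices.\<close>
      consider "x \<ge> 0" | "y \<ge> 0" | "x < 0" "y < 0" by linarith
      then have "Polygamma_defect i (exp x) (exp y) \<ge> 0"
      proof cases
        case 1
        then show ?thesis
          using Polygamma_defect_nonneg[of i "exp y" "exp x"] i by (simp add: Polygamma_defect_commute)
      next
        case 2
        then show ?thesis
          using Polygamma_defect_nonneg[of i "exp x" "exp y"] i by simp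
      next
        case 3
        then have "Polygamma_defect i \<theta> \<theta> < Polygamma_defect i (exp x) (exp y)"
          using \<theta> i xy by (intro Polygamma_defect_strict_mono2) (auto simp: above)
        then show ?thesis by (simp add: zero)
      qed
      then show "\<bar>Polygamma i (exp (x + y))\<bar> \<le> \<bar>Polygamma i (exp x)\<bar> + \<bar>Polygamma i (exp y)\<bar>"
        by (simp add: defect_exp)
    qed
  qed
  then show ?thesis
    unfolding root using Polygamma_defect_diag_zero[OF i] by auto
qed

end
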